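(* Let $\phi(x,z)=e^{zp(x)\frac{d}{dx}}(x)$ with $p(x)\in\mathbb{C}((x))$. Then $\phi(x,z)$ is equivalent to $F_{\mathrm{add}}(x,z)=x+z$ if and only if $p(x)\in\mathbb{C}[[x]]$ with $p(0)\neq0$.
   Context: An associate of $F_{\mathrm{add}}(x,y)=x+y$ is a formal series $\phi(x,z)\in\mathbb{C}((x))[[z]]$ satisfying $\phi(x,0)=x$ and $\phi(\phi(x,y),z)=\phi(x,y+z)$; for every $p(x)\in\mathbb{C}((x))$ the series $e^{zp(x)\frac{d}{dx}}(x)=\sum_{n\ge0}\frac{z^n}{n!}\left(p(x)\frac{d}{dx}\right)^n(x)$ is an associate, and $F_{\mathrm{add}}(x,z)=x+z$ is itself an associate. Let $G=\{f(x)\in x\mathbb{C}[[x]] : f'(0)\neq0\}$, a group under composition, with $f^{-1}$ denoting the compositional inverse. $G$ acts on the right on the set of associates by $\phi\mapsto\phi_f$, where $\phi_f(x,z)=f^{-1}(\phi(f(x),z))$. Two associates are called equivalent if they lie in the same orbit of this action, i.e. $\phi$ and $\psi$ are equivalent if $\phi=\psi_f$ for some $f\in G$. *)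

theory Defs
  imports
    "HOL-Computational_Algebra.Computational_Algebra"
    "HOL-Library.Groups_Big_Fun"
begin

unbundle Formal_Power_Series.fps_syntax and Formal_Laurent_Series.fps_syntax

text \<open>
  The ring \<open>C((x))[[z]]\<close> is \<^typ>\<open>complex fls fps\<close>: the inner Laurent variable is \<open>x\<close>, the outer
  variable is \<open>z\<close>.  Likewise \<open>C((x))[[y]][[z]]\<close> is \<^typ>\<open>complex fls fps fps\<close>, with \<open>z\<close> outermost.
\<close>

text \<open>
  Substitution of \<open>g(x,y)\<close> from \<open>C((x))[[y]]\<close> for the variable of a Laurent series
  \<open>a(x) = \<Sum> a\<^sub>n x\<^sup>n\<close>, that is \<open>a(g(x,y)) = \<Sum> a\<^sub>n g(x,y)\<^sup>n\<close>, computed coefficientwise.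
  It is meaningful when \<open>g(x,0)\<close> is a nonzero element of \<open>x C[[x]]\<close>: then \<open>g\<close> is invertible
  in \<open>C((x))[[y]]\<close>, every coefficient below is a finite sum, and the coefficient family of each
  \<open>y\<^sup>m\<close> is a Laurent series (see \<open>fls_subst_finite\<close> and \<open>fls_subst_nth\<close>).  Outside this situation
  the value is junk.
\<close>

definition fls_subst :: "complex fls \<Rightarrow> complex fls fps \<Rightarrow> complex fls fps" where
  "fls_subst a g =
     Abs_fps (\<lambda>m. Abs_fls (\<lambda>j. Sum_any (\<lambda>n::int. a $$ n * ((g powi n) $ m $$ j))))"

lemma fls_subst_mult_aux:
  fixes g h :: "complex fls fps" and d e K :: int
  assumes g: "\<And>i j. i \<le> m \<Longrightarrow> j < d - int i * K \<Longrightarrow> g $ i $$ j = 0"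
    and h: "\<And>i j. i \<le> m \<Longrightarrow> j < e - int i * K \<Longrightarrow> h $ i $$ j = 0"
    and i: "i \<le> m" and j: "j < d + e - int i * K"
  shows "(g * h) $ i $$ j = 0"
proof -
  have "(g $ k * h $ (i - k)) $$ j = 0" if k: "k \<le> i" for k
  proof (cases "g $ k = 0 \<or> h $ (i - k) = 0")
    case False
    have "d - int k * K \<le> fls_subdegree (g $ k)"
      using False g[of k] k i by (intro fls_subdegree_geI) auto
    moreover have "e - int (i - k) * K \<le> fls_subdegree (h $ (i - k))"
      using False h[of "i - k"] i by (intro fls_subdegree_geI) auto
    moreover have "int k * K + int (i - k) * K = int i * K"
      using k by (simp add: of_nat_diff algebra_simps)
    ultimately have "j < fls_subdegree (g $ k) + fls_subdegree (h $ (i - k))"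
      using j by linarith
    then show ?thesis by (simp add: fls_times_nth_eq0)
  qed auto
  then show ?thesis
    by (simp add: fps_mult_nth fls_nth_sum)
qed

lemma fls_subst_power_bound:
  fixes g :: "complex fls fps"
  assumes g0: "g $ 0 = fps_to_fls f" and f0: "f $ 0 = 0"
  obtains K :: int where "\<And>n j. j < int n - K \<Longrightarrow> (g ^ n) $ m $$ j = 0"
proof -
  define c :: int where "c = Max ((\<lambda>i. \<bar>fls_subdegree (g $ i)\<bar>) ` {..m})"
  have c: "\<bar>fls_subdegree (g $ i)\<bar> \<le> c" if "i \<le> m" for i
    unfolding c_def using that by (intro Max_ge) auto
  define K where "K = c + 1"
  have c0: "0 \<le> c" using c[of 0] by linarith
  have base: "g $ i $$ j = 0" if i: "i \<le> m" and j: "j < 1 - int i * K" for i j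
  proof (cases "i = 0")
    case True
    then have "j \<le> 0" using j by simp
    then show ?thesis using True g0 f0 by (cases "j = 0") auto
  next
    case False
    then have "1 * K \<le> int i * K"
      using c0 by (intro mult_right_mono) (auto simp: K_def)
    then have "j < 1 - K" using j by linarith
    then have "j < fls_subdegree (g $ i)"
      using c[OF i] unfolding K_def by linarith
    then show ?thesis by simp
  qed
  have "\<forall>i j. i \<le> m \<longrightarrow> j < int n - int i * K \<longrightarrow> (g ^ n) $ i $$ j = 0" for n
  proof (induction n)
    case 0
    have "(1 :: complex fls fps) $ i $$ j = 0" if "j < - (int i * K)" for i j
      using that by (cases "i = 0") auto
    then show ?case by simp
  next
    case (Suc n)
    have "(g * g ^ n) $ i $$ j = 0" if "i \<le> m" "j < 1 + int n - int i * K" for i j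
      using Suc base that by (intro fls_subst_mult_aux[of m 1 K g "int n" "g ^ n"]) auto
    then show ?case by simp
  qed
  then show thesis by (intro that[of "int m * K"]) auto
qed

lemma fls_subst_bounds:
  fixes g :: "complex fls fps"
  assumes g0: "g $ 0 = fps_to_fls f" and f0: "f $ 0 = 0"
  obtains K L :: int where
    "\<And>n j. a $$ n * ((g powi n) $ m $$ j) \<noteq> 0 \<Longrightarrow> fls_subdegree a \<le> n \<and> n \<le> max 0 (j + K) \<and> L \<le> j"
proof -
  obtain K :: int where K: "\<And>n j. j < int n - K \<Longrightarrow> (g ^ n) $ m $$ j = 0"
    using fls_subst_power_bound[OF assms, of m] by blast
  define N where "N = {fls_subdegree a..0}"
  define L where "L = Min (insert (- K) ((\<lambda>n. fls_subdegree ((g powi n) $ m)) ` N))"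
  show thesis
  proof (rule that[of K L], intro conjI)
    fix n j assume nz: "a $$ n * ((g powi n) $ m $$ j) \<noteq> 0"
    then show an: "fls_subdegree a \<le> n"
      by (intro fls_subdegree_leI) auto
    have pos: "n \<le> j + K" if "n \<ge> 0"
    proof -
      have "(g ^ nat n) $ m $$ j \<noteq> 0" using nz that by (auto simp: power_int_def)
      then show ?thesis using K[of j "nat n"] that by force
    qed
    then show "n \<le> max 0 (j + K)" by linarith
    show "L \<le> j"
    proof (cases "n \<le> 0")
      case True
      then have "L \<le> fls_subdegree ((g powi n) $ m)"
        unfolding L_def using an by (intro Min_le) (auto simp: N_def)
      also have "\<dots> \<le> j" using nz by (intro fls_subdegree_leI) auto
      finally show ?thesis .
    next
      case False
      have "L \<le> - K" unfolding L_def by (intro Min_le) (auto simp: N_def)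
      then show ?thesis using pos False by linarith
    qed
  qed
qed

lemma fls_subst_finite:
  fixes g :: "complex fls fps"
  assumes "g $ 0 = fps_to_fls f" "f $ 0 = 0"
  shows "finite {n. a $$ n * ((g powi n) $ m $$ j) \<noteq> 0}"
proof -
  obtain K L :: int where
    "\<And>n j. a $$ n * ((g powi n) $ m $$ j) \<noteq> 0 \<Longrightarrow> fls_subdegree a \<le> n \<and> n \<le> max 0 (j + K) \<and> L \<le> j"
    using fls_subst_bounds[OF assms, of a m] by blast
  then have "{n. a $$ n * ((g powi n) $ m $$ j) \<noteq> 0} \<subseteq> {fls_subdegree a..max 0 (j + K)}"
    by auto
  then show ?thesis by (rule finite_subset) simp
qed

lemma fls_subst_nth:
  fixes g :: "complex fls fps"
  assumes "g $ 0 = fps_to_fls f" "f $ 0 = 0"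
  shows "fls_subst a g $ m $$ j = Sum_any (\<lambda>n. a $$ n * ((g powi n) $ m $$ j))"
proof -
  obtain K L :: int where KL:
    "\<And>n j. a $$ n * ((g powi n) $ m $$ j) \<noteq> 0 \<Longrightarrow> fls_subdegree a \<le> n \<and> n \<le> max 0 (j + K) \<and> L \<le> j"
    using fls_subst_bounds[OF assms, of a m] by blast
  have "Sum_any (\<lambda>n. a $$ n * ((g powi n) $ m $$ j)) = 0" if "j < L" for j
  proof -
    have "a $$ n * ((g powi n) $ m $$ j) = 0" for n
      using KL[of n j] that by linarith
    then have "(\<lambda>n. a $$ n * ((g powi n) $ m $$ j)) = (\<lambda>n. 0)" by blast
    then show ?thesis by (simp only: Sum_any.neutral)
  qed
  then show ?thesis
    unfolding fls_subst_def by (simp add: nth_Abs_fls_lower_bound[of L])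
qed

text \<open>
  The second equation is \<open>\<phi>(\<phi>(x,y),z) = \<phi>(x,y+z)\<close> in \<open>C((x))[[y]][[z]]\<close>.  On the left the outer
  \<open>\<phi> = \<Sum> a\<^sub>n(x) z\<^sup>n\<close> is expanded in \<open>z\<close> and \<open>\<phi>(x,y)\<close> is substituted into each \<open>a\<^sub>n\<close>; on the
  right, \<open>z\<^sup>n y\<^sup>m\<close> occurs in \<open>(y+z)\<^sup>k\<close> only for \<open>k = n+m\<close>, with coefficient \<open>n+m choose n\<close>.
\<close>

definition associate :: "complex fls fps \<Rightarrow> bool" where
  "associate \<phi> \<longleftrightarrow>
     \<phi> $ 0 = fls_X \<and>
     Abs_fps (\<lambda>n. fls_subst (\<phi> $ n) \<phi>) =
       Abs_fps (\<lambda>n. Abs_fps (\<lambda>m. of_nat ((n + m) choose n) * \<phi> $ (n + m)))"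

definition F_add :: "complex fls fps" where
  "F_add = fps_const fls_X + fps_X"

definition exp_associate :: "complex fls \<Rightarrow> complex fls fps" where
  "exp_associate p =
     Abs_fps (\<lambda>n. fls_const (1 / fact n) * ((\<lambda>a. p * fls_deriv a) ^^ n) fls_X)"

definition G :: "complex fps set" where
  "G = {f. f $ 0 = 0 \<and> fps_deriv f $ 0 \<noteq> 0}"

text \<open>
  \<open>act \<phi> f\<close> is \<open>\<phi>\<^sub>f(x,z) = f\<^sup>-\<^sup>1(\<phi>(f(x),z))\<close>; the argument of the outer substitution is
  \<open>\<phi>(f(x),z)\<close>, obtained by composing each \<open>z\<close>-coefficient of \<open>\<phi>\<close> with \<open>f\<close>.
\<close>

definition act :: "complex fls fps \<Rightarrow> complex fps \<Rightarrow> complex fls fps" where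
  "act \<phi> f =
     fls_subst (fps_to_fls (fps_inv f)) (Abs_fps (\<lambda>n. fls_compose_fps (\<phi> $ n) f))"

definition equivalent :: "complex fls fps \<Rightarrow> complex fls fps \<Rightarrow> bool" where
  "equivalent \<phi> \<psi> \<longleftrightarrow> associate \<phi> \<and> associate \<psi> \<and> (\<exists>f\<in>G. \<phi> = act \<psi> f)"

end

theory Submission
  imports Defs
begin

text \<open>
  Write \<open>T = q d/dx\<close> for a power series \<open>q\<close> and \<open>E = exp (z T)\<close>. Since \<open>T\<close> is a derivation, \<open>E\<close> is
  a continuous ring homomorphism, so \<open>a(E b) = E (a \<circ> b)\<close> whenever \<open>b(0) = 0\<close>. For \<open>b = x\<close> this is
  the associate law for \<open>E x\<close>; in particular \<open>F_add\<close>, which is \<open>E x\<close> for \<open>q = 1\<close>, is an associate.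
  If \<open>q = 1/f'\<close>, then \<open>T f = 1\<close>, so \<open>f + z = E f\<close> and \<open>f\<inverse>(f + z) = E (f\<inverse> \<circ> f) = E x\<close>. Hence the
  orbit of \<open>F_add\<close> consists of the series \<open>E x\<close> with \<open>q = 1/f'\<close> and \<open>f \<in> G\<close>, and \<open>q\<close> is
  recovered as the coefficient of \<open>z\<close>.
\<close>

definition flow :: "'a::field_char_0 fps \<Rightarrow> 'a fps \<Rightarrow> 'a fps fps" where
  "flow q a = Abs_fps (\<lambda>n. fps_const (1 / fact n) * ((\<lambda>c. q * fps_deriv c) ^^ n) a)"

lemma flow_0 [simp]: "flow q a $ 0 = a"
  by (simp add: flow_def)

lemma flow_Suc: "flow q a $ Suc n = fps_const (1 / of_nat (Suc n)) * (q * fps_deriv (flow q a $ n))"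
proof -
  have "fps_const (1 / fact (Suc n)) = fps_const (1 / of_nat (Suc n)) * fps_const (1 / fact n :: 'a)"
    by simp
  then show ?thesis
    unfolding flow_def by (simp only: fps_nth_Abs_fps funpow.simps o_def fps_deriv_mult_const_left mult_ac)
qed

lemma flow_deriv: "of_nat (Suc n) * flow q a $ Suc n = q * fps_deriv (flow q a $ n)"
proof -
  have "of_nat (Suc n) * fps_const (1 / of_nat (Suc n)) = (1 :: 'a fps)"
    by (simp only: fps_of_nat [symmetric] fps_const_mult)
       (simp del: of_nat_Suc fps_of_nat)
  then show ?thesis
    unfolding flow_Suc by (metis mult.assoc mult_1)
qed

text \<open>The hypothesis is the equation dF/dz = q dF/dx read coefficientwise in z. In
  characteristic 0 it determines each coefficient from the previous one.\<close>

lemma flow_unique: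
  assumes "\<And>n. of_nat (Suc n) * F $ Suc n = q * fps_deriv (F $ n)"
  shows "F = flow q (F $ 0)"
proof (rule fps_ext)
  show "F $ n = flow q (F $ 0) $ n" for n
  proof (induction n)
    case (Suc n)
    have "of_nat (Suc n) * F $ Suc n = of_nat (Suc n) * flow q (F $ 0) $ Suc n"
      unfolding assms flow_deriv Suc ..
    then show ?case by (simp del: of_nat_Suc)
  qed simp
qed

text \<open>Both sides start at a b and solve dF/dz = T F, the right one by the Leibniz rule for
  \<open>T\<close> acting on z-coefficients.\<close>

lemma flow_mult: "flow q (a * b) = flow q a * flow q b"
proof -
  define T where "T = (\<lambda>F :: 'a fps fps. Abs_fps (\<lambda>n. q * fps_deriv (F $ n)))"
  have flow: "fps_deriv (flow q c) = T (flow q c)" for c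
    by (rule fps_ext) (use flow_deriv[of _ q c] in \<open>simp add: T_def\<close>)
  have "T (F * H) = T F * H + F * T H" for F H
    by (rule fps_ext)
       (simp add: T_def fps_mult_nth fps_deriv_sum sum_distrib_left sum.distrib distrib_left
        mult.assoc mult.left_commute add.commute)
  then have "fps_deriv (flow q a * flow q b) = T (flow q a * flow q b)"
    by (simp add: flow)
  then have "fps_deriv (flow q a * flow q b) $ n = T (flow q a * flow q b) $ n" for n
    by (rule arg_cong)
  then have "of_nat (Suc n) * (flow q a * flow q b) $ Suc n = q * fps_deriv ((flow q a * flow q b) $ n)" for n
    by (simp only: fps_deriv_nth T_def fps_nth_Abs_fps Suc_eq_plus1)
  then show ?thesis
    using flow_unique[of "flow q a * flow q b" q] by simp
qed

lemma flow_1: "flow q 1 = 1"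
  using flow_unique[of 1 q] by (simp add: fps_one_def)

lemma flow_power: "flow q (a ^ n) = flow q a ^ n"
  by (induction n) (simp_all add: flow_1 flow_mult)

text \<open>The one-parameter group law exp(zT) exp(yT) = exp((y+z)T), read off at z^m y^n.\<close>

lemma flow_flow_nth: "flow q (flow q a $ n) $ m = of_nat ((n + m) choose n) * flow q a $ (n + m)"
proof -
  have "((\<lambda>c. q * fps_deriv c) ^^ m) (fps_const k * b) = fps_const k * ((\<lambda>c. q * fps_deriv c) ^^ m) b" for k b
    by (induction m) (simp_all add: mult_ac)
  moreover have "fps_const (1 / fact m) * fps_const (1 / fact n) =
      (of_nat ((n + m) choose n) * fps_const (1 / fact (n + m)) :: 'a fps)"
    by (simp add: fps_of_nat [symmetric] binomial_fact field_simps del: fps_of_nat)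
  ultimately show ?thesis
    unfolding flow_def
    by (simp only: fps_nth_Abs_fps mult.assoc [symmetric] funpow_add o_apply add.commute [of n m])
qed

text \<open>Each application of q d/dx lowers the x-adic order by at most one. This is the
  continuity that allows infinite sums to be truncated.\<close>

lemma flow_cong_nth:
  assumes "\<And>k. k \<le> j + m \<Longrightarrow> a $ k = b $ k"
  shows "flow q a $ m $ j = flow q b $ m $ j"
  using assms
proof (induction m arbitrary: j)
  case (Suc m)
  then show ?case
    by (auto simp: flow_Suc fps_mult_nth simp del: of_nat_Suc intro!: sum.cong)
qed simp

lemma flow_sum_const:
  "flow q (\<Sum>i\<in>A. fps_const (c i) * a i) $ m = (\<Sum>i\<in>A. fps_const (c i) * flow q (a i) $ m)"
  by (induction m) (simp_all add: flow_Suc fps_deriv_sum sum_distrib_left mult_ac del: of_nat_Suc)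

lemma flow_compose_nth:
  fixes a b :: "'a::field_char_0 fps"
  assumes "b $ 0 = 0"
  shows "flow q (a oo b) $ m $ j = (\<Sum>n\<le>j + m. a $ n * (flow q b ^ n) $ m $ j)"
proof -
  \<comment> \<open>Since b has no constant term, powers of b beyond j + m do not reach the
    coefficients that matter, so the composition becomes a polynomial in b.\<close>
  have "(a oo b) $ k = (\<Sum>n\<le>j + m. fps_const (a $ n) * b ^ n) $ k" if "k \<le> j + m" for k
    unfolding fps_compose_nth
    using that assms by (auto simp: fps_sum_nth startsby_zero_power_prefix intro!: sum.mono_neutral_left)
  then have "flow q (a oo b) $ m $ j = flow q (\<Sum>n\<le>j + m. fps_const (a $ n) * b ^ n) $ m $ j"
    by (rule flow_cong_nth)
  then show ?thesis
    by (simp add: flow_sum_const flow_power fps_sum_nth)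
qed

lemma flow_power_nth_eq_0:
  assumes "b $ 0 = 0" "j + m < n"
  shows "(flow q b ^ n) $ m $ j = 0"
proof -
  have "flow q (b ^ n) $ m $ j = flow q 0 $ m $ j"
    by (rule flow_cong_nth) (use assms in \<open>simp add: startsby_zero_power_prefix\<close>)
  also have "flow q 0 $ m = 0"
    using flow_sum_const[where A = "{}"] by simp
  finally show ?thesis by (simp add: flow_power)
qed

definition lift_fls :: "'a::comm_ring_1 fps fps \<Rightarrow> 'a fls fps" where
  "lift_fls F = Abs_fps (\<lambda>n. fps_to_fls (F $ n))"

lemma lift_fls_nth [simp]: "lift_fls F $ n = fps_to_fls (F $ n)"
  by (simp add: lift_fls_def)

lemma fps_to_fls_sum: "fps_to_fls (\<Sum>x\<in>A. f x) = (\<Sum>x\<in>A. fps_to_fls (f x))"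
  by (induction A rule: infinite_finite_induct) simp_all

lemma lift_fls_power: "lift_fls (F ^ n) = lift_fls F ^ n"
proof (induction n)
  case 0
  show ?case by (rule fps_ext) (simp add: fps_one_nth)
next
  case (Suc n)
  have "lift_fls (F * F ^ n) = lift_fls F * lift_fls (F ^ n)"
    by (rule fps_ext) (simp add: fps_mult_nth fls_times_fps_to_fls fps_to_fls_sum)
  then show ?case using Suc by simp
qed

lemma exp_associate_fps: "exp_associate (fps_to_fls q) = lift_fls (flow q fps_X)"
proof -
  have "((\<lambda>a. fps_to_fls q * fls_deriv a) ^^ n) fls_X =
      fps_to_fls (((\<lambda>c. q * fps_deriv c) ^^ n) fps_X)" for n
    by (induction n) (simp_all add: fls_times_fps_to_fls fls_deriv_fps_to_fls)
  then show ?thesis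
    by (intro fps_ext) (simp add: exp_associate_def flow_def fls_times_fps_to_fls)
qed

lemma fls_subst_flow:
  assumes b: "b $ 0 = 0"
  shows "fls_subst (fps_to_fls a) (lift_fls (flow q b)) = lift_fls (flow q (a oo b))"
proof (rule fps_ext, rule fls_eqI)
  fix m :: nat and j :: int
  let ?g = "lift_fls (flow q b)"
  define t where "t = (\<lambda>n. fps_to_fls a $$ n * (?g powi n) $ m $$ j)"
  \<comment> \<open>For j < 0 all terms vanish, so the truncation \<open>nat j = 0\<close> does no
    harm.\<close>
  define N where "N = nat j + m"
  have t: "t (int n) = (if j < 0 then 0 else a $ n * (flow q b ^ n) $ m $ nat j)" for n
    by (simp add: t_def lift_fls_power [symmetric])
  \<comment> \<open>Negative n drop out because a is a power series, large n because b^n has x-order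
    at least n.\<close>
  have "t n = 0" if "n \<notin> int ` {..N}" for n
  proof (cases "n < 0")
    case True
    then show ?thesis by (simp add: t_def)
  next
    case False
    then obtain k where "n = int k" by (metis nonneg_int_cases not_less)
    then show ?thesis
      using that flow_power_nth_eq_0[OF b, of "nat j" m k q] by (auto simp: t N_def inj_image_mem_iff)
  qed
  then have "Sum_any t = sum t (int ` {..N})"
    by (intro Sum_any.expand_superset) auto
  also have "\<dots> = (\<Sum>n\<le>N. t (int n))"
    by (simp add: sum.reindex)
  also have "\<dots> = fps_to_fls (flow q (a oo b) $ m) $$ j"
    by (simp add: t N_def flow_compose_nth[OF b])
  finally show "fls_subst (fps_to_fls a) ?g $ m $$ j = lift_fls (flow q (a oo b)) $ m $$ j"
    by (simp add: t_def fls_subst_nth[OF _ b])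
qed

lemma associate_exp_associate_fps: "associate (exp_associate (fps_to_fls q))"
proof -
  have "of_nat k * fps_to_fls c = fps_to_fls (of_nat k * c)" for k and c :: "complex fps"
    by (simp add: fls_times_fps_to_fls)
  then show ?thesis
    unfolding associate_def exp_associate_fps
    \<comment> \<open>With b = x, substituting E x into the z^n-coefficient applies E to it; the
      group law then gives the binomial.\<close>
    by (auto simp: fps_eq_iff fls_subst_flow flow_flow_nth intro!: fps_ext)
qed

text \<open>Here T f = 1 and T 1 = 0, so the exponential series stops after its linear term.\<close>

lemma lift_fls_flow_eq_plus:
  assumes "q * fps_deriv f = 1"
  shows "lift_fls (flow q f) = fps_const (fps_to_fls f) + fps_X"
proof -
  have "flow q f $ Suc n = (if n = 0 then 1 else 0)" for n
    by (induction n) (simp_all add: flow_Suc assms)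
  then have "lift_fls (flow q f) $ n = (fps_const (fps_to_fls f) + fps_X) $ n" for n
    by (cases n) (simp_all add: fps_X_def)
  then show ?thesis by (rule fps_ext)
qed

lemma F_add_eq_exp_associate: "F_add = exp_associate 1"
  using lift_fls_flow_eq_plus[of 1 "fps_X :: complex fps"] exp_associate_fps[of 1]
  by (simp add: F_add_def)

lemma act_F_add:
  assumes f: "f \<in> G"
  shows "act F_add f = exp_associate (fps_to_fls (inverse (fps_deriv f)))"
proof -
  let ?q = "inverse (fps_deriv f)"
  have f0: "f $ 0 = 0" and f1: "fps_deriv f $ 0 \<noteq> 0" using f by (auto simp: G_def)
  then have "f \<noteq> 0" by auto
  have "Abs_fps (\<lambda>n. fls_compose_fps (F_add $ n) f) = fps_const (fps_to_fls f) + fps_X"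
    by (rule fps_ext) (use f0 \<open>f \<noteq> 0\<close> in \<open>auto simp: F_add_def fps_X_def\<close>)
  also have "\<dots> = lift_fls (flow ?q f)"
    using inverse_mult_eq_1[OF f1] by (rule lift_fls_flow_eq_plus [symmetric])
  finally show ?thesis
    using f0 f1 by (simp add: act_def fls_subst_flow fps_inv exp_associate_fps)
qed

lemma exp_associate_nth_1: "exp_associate p $ 1 = p"
  by (simp add: exp_associate_def)

theorem lemma2p16:
  fixes p :: "complex fls" and \<phi> :: "complex fls fps"
  assumes "\<phi> = exp_associate p"
  shows "equivalent \<phi> F_add \<longleftrightarrow> (\<exists>q :: complex fps. p = fps_to_fls q \<and> q $ 0 \<noteq> 0)"
proof
  assume "equivalent \<phi> F_add"
  then obtain f where f: "f \<in> G" "\<phi> = act F_add f" by (auto simp: equivalent_def)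
  then have "p = fps_to_fls (inverse (fps_deriv f))"
    using assms by (metis act_F_add exp_associate_nth_1)
  then show "\<exists>q. p = fps_to_fls q \<and> q $ 0 \<noteq> 0"
    using f(1) by (intro exI[of _ "inverse (fps_deriv f)"]) (simp add: G_def)
next
  assume "\<exists>q. p = fps_to_fls q \<and> q $ 0 \<noteq> 0"
  then obtain q where q: "p = fps_to_fls q" "q $ 0 \<noteq> 0" by blast
  \<comment> \<open>Solves 1/f' = q; the integration constant 0 gives f(0) = 0, and q(0) nonzero
    gives f'(0) nonzero.\<close>
  define f where "f = fps_integral0 (inverse q)"
  have f: "fps_deriv f = inverse q"
    by (simp add: f_def fps_deriv_fps_integral)
  then have "f \<in> G" using q(2) by (simp add: G_def f_def)
  moreover have "\<phi> = act F_add f"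
    using q \<open>f \<in> G\<close> by (simp add: assms act_F_add f fps_inverse_idempotent)
  moreover have "associate \<phi>" "associate F_add"
    using associate_exp_associate_fps[of q] associate_exp_associate_fps[of 1]
    by (simp_all add: assms q(1) F_add_eq_exp_associate)
  ultimately show "equivalent \<phi> F_add" by (auto simp: equivalent_def)
qed

end
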